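(* Let $a,b\in\mathbb{R}$ with $a\neq b$ and $b\neq 0$, and let $\mu$ be the KV-structure on $\mathbb{R}^2$ given by $$\mu=\left(\begin{pmatrix} 0 & a \\ a & 0 \end{pmatrix},\begin{pmatrix} b & 0 \\ 0 & a \end{pmatrix}\right),$$ assumed Hessian. Then: (i) $H_{KV}^{0}(\mu)\simeq\mathbb{R}^{2}$; (ii) $H_{KV}^{1}(\mu)\simeq\{0\}$.
   Context: Fix a basis $(e_1,e_2)$ of $\mathbb{R}^2$. A bilinear map $\mu$ on $\mathbb{R}^2$, also written $uv=\mu(u,v)$, is identified with a pair of matrices $(\Gamma_1,\Gamma_2)$ by $\mu(u,v)=(u^t\Gamma_1v,\,u^t\Gamma_2v)$. Put $Ass_\mu(u,v,w)=(uv)w-u(vw)$. $\mu$ is a KV-structure if $Ass_\mu(u,v,w)=Ass_\mu(v,u,w)$ for all $u,v,w$. A KV-structure is Hessian if it is symmetric and non-degenerate, meaning both $\Gamma_1$ and $\Gamma_2$ are symmetric and invertible. The KV-complex is $0\xrightarrow{\delta^{-1}}C^0(\mathbb{R}^2)\xrightarrow{\delta^0}C^1(\mathbb{R}^2)\xrightarrow{\delta^1}C^2(\mathbb{R}^2)\to\cdots$, where $C^0(\mathbb{R}^2)=J(\mathbb{R}^2)=\{\xi\in\mathbb{R}^2: Ass_\mu(u,v,\xi)=0\ \forall u,v\in\mathbb{R}^2\}$, and for $q\ge1$, $C^q(\mathbb{R}^2)$ is the space of $q$-linear maps $(\mathbb{R}^2)^q\to\mathbb{R}^2$. The coboundaries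 are $\delta^0(\xi)(u)=-u\xi+\xi u$ and $\delta^1f(u,v)=-u f(v)+f(uv)-f(u)v$. The cohomology spaces are $H^q_{KV}(\mu)=\ker\delta^q/\operatorname{Im}\delta^{q-1}$, and $\simeq$ denotes isomorphism of real vector spaces. *)

theory Defs
  imports "HOL-Analysis.Analysis" "HOL-Library.Function_Algebras"
begin

instantiation "fun" :: (type, real_vector) real_vector
begin

definition scaleR_fun_def: "c *\<^sub>R f = (\<lambda>x. c *\<^sub>R f x)"

instance
  by standard (simp_all add: fun_eq_iff scaleR_fun_def scaleR_add_right scaleR_add_left)

end

lemma scaleR_fun_apply [simp]: "(c *\<^sub>R f) x = c *\<^sub>R f x"
  by (simp add: scaleR_fun_def)

record 'a vspace =
  vcarrier :: "'a set"
  vadd :: "'a \<Rightarrow> 'a \<Rightarrow> 'a"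
  vscale :: "real \<Rightarrow> 'a \<Rightarrow> 'a"

definition vspace_of :: "'a::real_vector set \<Rightarrow> 'a vspace" where
  "vspace_of V = \<lparr>vcarrier = V, vadd = (+), vscale = (*\<^sub>R)\<rparr>"

definition coset :: "'a::real_vector set \<Rightarrow> 'a \<Rightarrow> 'a set" where
  "coset W x = {x + w | w. w \<in> W}"

text \<open>In the scaling of a coset the summand in \<open>W\<close> is needed only for \<open>c = 0\<close>, where the
  elementwise multiple of a coset is \<open>{0}\<close> rather than \<open>W\<close>.\<close>

definition quotient_vspace :: "'a::real_vector set \<Rightarrow> 'a set \<Rightarrow> 'a set vspace" where
  "quotient_vspace V W =
     \<lparr>vcarrier = coset W ` V,
      vadd = (\<lambda>A B. {x + y | x y. x \<in> A \<and> y \<in> B}),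
      vscale = (\<lambda>c A. {c *\<^sub>R x + w | x w. x \<in> A \<and> w \<in> W})\<rparr>"

definition vspace_isomorphic :: "'a vspace \<Rightarrow> 'b vspace \<Rightarrow> bool" where
  "vspace_isomorphic A B \<longleftrightarrow>
     (\<exists>\<phi>. bij_betw \<phi> (vcarrier A) (vcarrier B) \<and>
        (\<forall>x\<in>vcarrier A. \<forall>y\<in>vcarrier A. \<phi> (vadd A x y) = vadd B (\<phi> x) (\<phi> y)) \<and>
        (\<forall>c. \<forall>x\<in>vcarrier A. \<phi> (vscale A c x) = vscale B c (\<phi> x)))"

lemma vadd_quotient_vspace:
  assumes "subspace W"
  shows "vadd (quotient_vspace V W) (coset W x) (coset W y) = coset W (x + y)"
proof -
  have "\<exists>a b. x + y + w = a + b \<and> (\<exists>w. a = x + w \<and> w \<in> W) \<and> (\<exists>w. b = y + w \<and> w \<in> W)"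
    if "w \<in> W" for w
    by (rule exI[of _ "x + w"], rule exI[of _ y])
       (use that assms subspace_0 in \<open>force simp: algebra_simps\<close>)
  moreover have "\<exists>w. (x + w1) + (y + w2) = x + y + w \<and> w \<in> W" if "w1 \<in> W" "w2 \<in> W" for w1 w2
    by (rule exI[of _ "w1 + w2"]) (use that assms in \<open>auto simp: subspace_add algebra_simps\<close>)
  ultimately show ?thesis
    unfolding quotient_vspace_def coset_def by fastforce
qed

lemma vscale_quotient_vspace:
  assumes "subspace W"
  shows "vscale (quotient_vspace V W) c (coset W x) = coset W (c *\<^sub>R x)"
proof -
  have "\<exists>a w'. c *\<^sub>R x + w = c *\<^sub>R a + w' \<and> (\<exists>w. a = x + w \<and> w \<in> W) \<and> w' \<in> W"
    if "w \<in> W" for w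
    by (rule exI[of _ x], rule exI[of _ w]) (use that assms subspace_0 in force)
  moreover have "\<exists>w. c *\<^sub>R (x + w1) + w2 = c *\<^sub>R x + w \<and> w \<in> W" if "w1 \<in> W" "w2 \<in> W" for w1 w2
    by (rule exI[of _ "c *\<^sub>R w1 + w2"])
       (use that assms in \<open>auto simp: subspace_add subspace_scale algebra_simps\<close>)
  ultimately show ?thesis
    unfolding quotient_vspace_def coset_def by fastforce
qed

definition bilin_of :: "real^2^2 \<Rightarrow> real^2^2 \<Rightarrow> real^2 \<Rightarrow> real^2 \<Rightarrow> real^2" where
  "bilin_of \<Gamma>\<^sub>1 \<Gamma>\<^sub>2 u v = vector [u \<bullet> (\<Gamma>\<^sub>1 *v v), u \<bullet> (\<Gamma>\<^sub>2 *v v)]"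

definition Ass :: "(real^2 \<Rightarrow> real^2 \<Rightarrow> real^2) \<Rightarrow> real^2 \<Rightarrow> real^2 \<Rightarrow> real^2 \<Rightarrow> real^2" where
  "Ass \<mu> u v w = \<mu> (\<mu> u v) w - \<mu> u (\<mu> v w)"

definition KV_structure :: "(real^2 \<Rightarrow> real^2 \<Rightarrow> real^2) \<Rightarrow> bool" where
  "KV_structure \<mu> \<longleftrightarrow> bilinear \<mu> \<and> (\<forall>u v w. Ass \<mu> u v w = Ass \<mu> v u w)"

definition Hessian :: "real^2^2 \<Rightarrow> real^2^2 \<Rightarrow> bool" where
  "Hessian \<Gamma>\<^sub>1 \<Gamma>\<^sub>2 \<longleftrightarrow> KV_structure (bilin_of \<Gamma>\<^sub>1 \<Gamma>\<^sub>2) \<and>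
     transpose \<Gamma>\<^sub>1 = \<Gamma>\<^sub>1 \<and> transpose \<Gamma>\<^sub>2 = \<Gamma>\<^sub>2 \<and> invertible \<Gamma>\<^sub>1 \<and> invertible \<Gamma>\<^sub>2"

lemma bilinear_bilin_of: "bilinear (bilin_of \<Gamma>\<^sub>1 \<Gamma>\<^sub>2)"
  by (auto simp: bilinear_def bilin_of_def vec_eq_iff forall_2 algebra_simps
      inner_add_left inner_add_right matrix_vector_mult_add_rdistrib
      matrix_vector_right_distrib matrix_vector_mult_scaleR intro!: linearI)

definition J :: "(real^2 \<Rightarrow> real^2 \<Rightarrow> real^2) \<Rightarrow> (real^2) set" where
  "J \<mu> = {\<xi>. \<forall>u v. Ass \<mu> u v \<xi> = 0}"

definition C0 :: "(real^2 \<Rightarrow> real^2 \<Rightarrow> real^2) \<Rightarrow> (real^2) set" where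
  "C0 \<mu> = J \<mu>"

definition C1 :: "(real^2 \<Rightarrow> real^2) set" where
  "C1 = {f. linear f}"

definition C2 :: "(real^2 \<Rightarrow> real^2 \<Rightarrow> real^2) set" where
  "C2 = {f. bilinear f}"

definition d0 :: "(real^2 \<Rightarrow> real^2 \<Rightarrow> real^2) \<Rightarrow> real^2 \<Rightarrow> (real^2 \<Rightarrow> real^2)" where
  "d0 \<mu> \<xi> = (\<lambda>u. - \<mu> u \<xi> + \<mu> \<xi> u)"

definition d1 ::
  "(real^2 \<Rightarrow> real^2 \<Rightarrow> real^2) \<Rightarrow> (real^2 \<Rightarrow> real^2) \<Rightarrow> (real^2 \<Rightarrow> real^2 \<Rightarrow> real^2)" where
  "d1 \<mu> f = (\<lambda>u v. - \<mu> u (f v) + f (\<mu> u v) - \<mu> (f u) v)"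

text \<open>The incoming coboundary in degree \<open>0\<close> is the zero map from the zero space, so its image
  is \<open>{0}\<close>.\<close>

definition H0_KV :: "(real^2 \<Rightarrow> real^2 \<Rightarrow> real^2) \<Rightarrow> (real^2) set vspace" where
  "H0_KV \<mu> = quotient_vspace {\<xi> \<in> C0 \<mu>. d0 \<mu> \<xi> = 0} {0}"

definition H1_KV :: "(real^2 \<Rightarrow> real^2 \<Rightarrow> real^2) \<Rightarrow> (real^2 \<Rightarrow> real^2) set vspace" where
  "H1_KV \<mu> = quotient_vspace {f \<in> C1. d1 \<mu> f = 0} (d0 \<mu> ` C0 \<mu>)"

lemma subspace_C0:
  assumes "bilinear \<mu>"
  shows "subspace (C0 \<mu>)"
  using assms
  by (auto simp: subspace_def C0_def J_def Ass_def bilinear_ladd bilinear_radd bilinear_lzero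
      bilinear_rzero bilinear_lmul bilinear_rmul algebra_simps)

lemma subspace_d0_C0:
  assumes "bilinear \<mu>"
  shows "subspace (d0 \<mu> ` C0 \<mu>)"
proof -
  have "linear (d0 \<mu>)"
    using assms
    by (intro linearI)
       (auto simp: d0_def fun_eq_iff bilinear_ladd bilinear_radd bilinear_lmul bilinear_rmul
         algebra_simps)
  then show ?thesis
    using subspace_C0[OF assms] by (rule linear_subspace_image)
qed

lemma d0_in_C1:
  assumes "bilinear \<mu>"
  shows "d0 \<mu> \<xi> \<in> C1"
  unfolding C1_def d0_def using assms
  by (auto intro!: linearI
      simp: bilinear_ladd bilinear_radd bilinear_lmul bilinear_rmul algebra_simps)

lemma d1_in_C2:
  assumes "bilinear \<mu>" "f \<in> C1"
  shows "d1 \<mu> f \<in> C2"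
  using assms unfolding C1_def C2_def d1_def mem_Collect_eq
  by (subst bilinear_def)
     (auto intro!: linearI simp: linear_add linear_cmul
       bilinear_ladd bilinear_radd bilinear_lmul bilinear_rmul algebra_simps)

lemma d1_d0:
  assumes "KV_structure \<mu>" "\<xi> \<in> C0 \<mu>"
  shows "d1 \<mu> (d0 \<mu> \<xi>) = 0"
proof (intro ext)
  fix u v
  have b: "bilinear \<mu>" and s: "Ass \<mu> \<xi> u v = Ass \<mu> u \<xi> v" and z: "Ass \<mu> u v \<xi> = 0"
    using assms by (auto simp: KV_structure_def C0_def J_def)
  from s z show "d1 \<mu> (d0 \<mu> \<xi>) u v = 0 u v"
    unfolding d0_def d1_def Ass_def
    by (simp add: bilinear_ladd[OF b] bilinear_radd[OF b] bilinear_lneg[OF b] bilinear_rneg[OF b]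
        bilinear_lsub[OF b] bilinear_rsub[OF b] algebra_simps)
qed

end

(* The algebra (R^2, mu) is commutative and associative with unit e_2/a, where a is nonzero
   because Gamma_1 is invertible. Hence J is all of R^2 and delta^0 = 0, which gives H^0.
   A 1-cocycle is then a derivation: it kills the unit, hence e_2, and applying it to
   e_1 e_1 = b e_2 gives e_1 f(e_1) = 0, so f(e_1) = 0 since e_1 is not a zero divisor. *)
theory Submission
  imports Defs
begin

text \<open>Cosets of \<open>{0}\<close> are singletons, so \<open>the_elem\<close> undoes the
  passage to the quotient and composing it with \<open>f\<close> gives the isomorphism. A general
  injective \<open>f\<close> lets the target live in another type; it is the identity for
  \<open>H0_KV\<close> and the zero map for \<open>H1_KV\<close>.\<close>

lemma quotient_vspace_zero_isomorphic:
  assumes f: "linear f" and inj: "inj_on f V"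
  shows "vspace_isomorphic (quotient_vspace V {0}) (vspace_of (f ` V))"
proof -
  have coset: "coset {0} x = {x}" for x :: 'a
    by (simp add: coset_def)
  have add: "vadd (quotient_vspace V {0}) {x} {y} = {x + y}" for x y
    by (simp add: quotient_vspace_def)
  have scale: "vscale (quotient_vspace V {0}) c {x} = {c *\<^sub>R x}" for c x
    by (simp add: quotient_vspace_def)
  have carrier: "vcarrier (quotient_vspace V {0}) = (\<lambda>x. {x}) ` V"
    by (simp add: quotient_vspace_def coset)
  have "bij_betw (\<lambda>A. f (the_elem A)) ((\<lambda>x. {x}) ` V) (f ` V)"
    using inj by (auto simp: bij_betw_def inj_on_def image_image)
  then show ?thesis
    unfolding vspace_isomorphic_def carrier
    by (intro exI[of _ "\<lambda>A. f (the_elem A)"])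
       (auto simp: add scale vspace_of_def linear_add[OF f] linear_cmul[OF f])
qed

lemma bilin_of_hessian_form:
  "bilin_of (vector [vector [0, a], vector [a, 0]]) (vector [vector [b, 0], vector [0, a]]) u v =
    vector [a * (u $ 1 * v $ 2 + u $ 2 * v $ 1), b * u $ 1 * v $ 1 + a * u $ 2 * v $ 2]"
  by (simp add: bilin_of_def inner_vec_def matrix_vector_mult_def sum_2 algebra_simps
      vec_eq_iff forall_2)

theorem theorem5:
  fixes a b :: real and \<Gamma>\<^sub>1 \<Gamma>\<^sub>2 :: "real^2^2" and \<mu> :: "real^2 \<Rightarrow> real^2 \<Rightarrow> real^2"
  assumes "a \<noteq> b" and "b \<noteq> 0"
    and "\<Gamma>\<^sub>1 = vector [vector [0, a], vector [a, 0]]"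
    and "\<Gamma>\<^sub>2 = vector [vector [b, 0], vector [0, a]]"
    and "\<mu> = bilin_of \<Gamma>\<^sub>1 \<Gamma>\<^sub>2"
    and "Hessian \<Gamma>\<^sub>1 \<Gamma>\<^sub>2"
  shows "vspace_isomorphic (H0_KV \<mu>) (vspace_of (UNIV :: (real^2) set)) \<and>
    vspace_isomorphic (H1_KV \<mu>) (vspace_of {0 :: real^2})"
proof
  have \<mu>: "\<mu> u v =
      vector [a * (u $ 1 * v $ 2 + u $ 2 * v $ 1), b * u $ 1 * v $ 1 + a * u $ 2 * v $ 2]" for u v
    by (simp add: assms(3-5) bilin_of_hessian_form)
  have "a \<noteq> 0"
    using assms(3,6) by (auto simp: Hessian_def invertible_det_nz det_2)
  \<comment> \<open>Associativity is a polynomial identity in the coordinates. In structural terms,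
    with \<open>e_2/a\<close> as unit and \<open>e_1\<close> as \<open>x\<close>, the algebra is
    R[x]/(x^2 - ab).\<close>
  have J: "C0 \<mu> = UNIV"
    by (auto simp: C0_def J_def Ass_def \<mu> vec_eq_iff forall_2 algebra_simps)
  have d0: "d0 \<mu> \<xi> = 0" for \<xi>
    by (simp add: d0_def \<mu> fun_eq_iff algebra_simps)
  show "vspace_isomorphic (H0_KV \<mu>) (vspace_of (UNIV :: (real^2) set))"
    using quotient_vspace_zero_isomorphic[OF linear_id, of UNIV]
    by (simp add: H0_KV_def J d0)
  have "f = 0" if f: "linear f" and "d1 \<mu> f = 0" for f
  proof -
    have derivation: "f (\<mu> u v) = \<mu> u (f v) + \<mu> (f u) v" for u v
      using fun_cong[OF fun_cong[OF \<open>d1 \<mu> f = 0\<close>], of u v] by (simp add: d1_def algebra_simps)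
    define e1 e2 :: "real^2" where "e1 = vector [1, 0]" and "e2 = vector [0, 1]"
    note e = e1_def e2_def
    have "\<mu> e2 e2 = a *\<^sub>R e2" "\<mu> e1 e1 = b *\<^sub>R e2"
      by (simp_all add: \<mu> e vec_eq_iff forall_2)
    then have sq: "a *\<^sub>R f e2 = \<mu> e2 (f e2) + \<mu> (f e2) e2"
        "b *\<^sub>R f e2 = \<mu> e1 (f e1) + \<mu> (f e1) e1"
      using derivation[of e2 e2] derivation[of e1 e1] by (simp_all add: linear_cmul[OF f])
    \<comment> \<open>Multiplication by \<open>e2\<close> on either side is \<open>a\<close> times
      the identity, so \<open>sq(1)\<close> reads
      \<open>a *\<^sub>R f e2 = (2 * a) *\<^sub>R f e2\<close>.\<close>
    have f2: "f e2 = 0"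
      using sq(1) \<open>a \<noteq> 0\<close> by (simp add: \<mu> e vec_eq_iff forall_2)
    \<comment> \<open>Multiplication by \<open>e1\<close> sends \<open>(x, y)\<close> to
      \<open>(a * y, b * x)\<close>, which is injective since both factors are nonzero; now
      \<open>sq(2)\<close> says that twice the image of \<open>f e1\<close> vanishes.\<close>
    have f1: "f e1 = 0"
      using sq(2) \<open>a \<noteq> 0\<close> \<open>b \<noteq> 0\<close> unfolding f2 by (simp add: \<mu> e vec_eq_iff forall_2)
    have decomp: "x = x $ 1 *\<^sub>R e1 + x $ 2 *\<^sub>R e2" for x :: "real^2"
      by (simp add: e vec_eq_iff forall_2)
    have "f x = 0" for x
      by (subst decomp[of x]) (simp add: linear_add[OF f] linear_cmul[OF f] f1 f2)
    then show "f = 0"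
      by (simp add: fun_eq_iff)
  qed
  moreover have "0 \<in> C1" "d1 \<mu> 0 = 0"
    by (auto simp: C1_def d1_def \<mu> fun_eq_iff vec_eq_iff forall_2 intro!: linearI)
  ultimately have "{f \<in> C1. d1 \<mu> f = 0} = {0}"
    by (auto simp: C1_def)
  moreover have "d0 \<mu> ` C0 \<mu> = {0}"
    by (auto simp: J d0)
  \<comment> \<open>On the one-element space of cocycles the zero map is injective, and it leads
    from functions to vectors in \<open>real^2\<close>.\<close>
  ultimately show "vspace_isomorphic (H1_KV \<mu>) (vspace_of {0 :: real^2})"
    using quotient_vspace_zero_isomorphic[OF linear_zero,
        of "{0} :: (real^2 \<Rightarrow> real^2) set", where 'b = "real^2"]
    by (simp add: H1_KV_def)
qed

end
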